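(* Let $\lambda/\mu$ be a skew shape with $n$ boxes and let $A_{S,T}$ ($S,T\in\mathrm{SYT}(\lambda/\mu)$) be the change-of-basis coefficients defined by $n_T=\sum_{S\in\mathrm{SYT}(\lambda/\mu)}A_{S,T}v_S$, where $\{n_T\}$ and $\{v_T\}$ are the natural and seminormal bases of $\mathbb{S}_n^{\lambda/\mu}$. For any $T\in\mathrm{SYT}(\lambda/\mu)$, $$A_{T,T}=\prod_{(i,j)\in\mathrm{inv}(T)}\bigl(1+a_{i,j}(T)\bigr).$$
   Context: A skew shape $\lambda/\mu$ (partitions $\mu\subseteq\lambda$) is the set of boxes in the diagram of $\lambda$ not in that of $\mu$; position $(x,y)$ means row $x$ (counted downward) and column $y$ of $\lambda$. A Young tableau of shape $\lambda/\mu$ ($n$ boxes) is a filling by $1,\dots,n$, each used once; it is standard if entries increase left to right in rows and top to bottom in columns. $\mathrm{SYT}(\lambda/\mu)$ is the set of standard tableaux. A permutation $\sigma\in\mathbb{S}_n$ acts on tableaux by replacing each entry $k$ by $\sigma(k)$; $s_i=(i,i+1)$. The column reading tableau $C$ is the standard tableau obtained by entering $1,\dots,n$ consecutively down the columns, beginning with the southwest-most connected component and filling columns from left to right. For a tableau $T$, $w_T\in\mathbb{S}_n$ is the unique permutation with $w_T(C)=T$. An inversion in a standard tableau $T$ is a pair $(i,j)$ with $i>j$ such that $i$ lies strictly south and strictly west of $j$ in $T$; $\mathrm{inv}(T)$ is the set of inversions of $T$. The content of a box $b$ in position $(x,y)$ of $\lambda$ is $ct(b)=y-x$. For $T\in\mathrm{SYT}(\lambda/\mu)$,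 let $T(i)$ be the box of $T$ containing $i$, $a_{i,j}(T)=\dfrac{1}{ct(T(j))-ct(T(i))}$ and $a_i(T)=a_{i,i+1}(T)$. $\mathbb{S}_n^{\lambda/\mu}$ is the $\mathbb{C}$-vector space with basis $\{v_T\mid T\in\mathrm{SYT}(\lambda/\mu)\}$ (the seminormal basis), made into a $\mathbb{C}\mathbb{S}_n$-module by $$s_iv_T=a_i(T)v_T+(1+a_i(T))v_{s_i(T)},\qquad v_{s_i(T)}=0\text{ if }s_i(T)\text{ is nonstandard}.$$ The natural basis is $\{n_T\mid T\in\mathrm{SYT}(\lambda/\mu)\}$ with $n_T:=w_Tv_C$. *)

theory Defs
  imports Complex_Main "HOL-Algebra.Group_Action" "HOL-Algebra.Sym_Groups"
    "HOL-Library.Function_Algebras"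
begin

text \<open>Boxes are pairs (row, column), rows counted downward. Both coordinates start at 0;
  this shift of the usual convention does not change the content of a box.\<close>

type_synonym box = "nat \<times> nat"
type_synonym tableau = "box \<Rightarrow> nat"

definition is_partition :: "(nat \<Rightarrow> nat) \<Rightarrow> bool" where
  "is_partition la \<longleftrightarrow> antimono la \<and> finite {x. la x \<noteq> 0}"

definition diagram :: "(nat \<Rightarrow> nat) \<Rightarrow> box set" where
  "diagram la = {(x, y). y < la x}"

definition content :: "box \<Rightarrow> int" where
  "content b = int (snd b) - int (fst b)"

text \<open>A tableau of shape \<open>D\<close> is 0 outside \<open>D\<close>. Hence there are only finitely many of them, and
  since a permutation of \<open>{1..card D}\<close> fixes 0, it acts on them by composition.\<close>

definition young_tableaux :: "box set \<Rightarrow> tableau set" where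
  "young_tableaux D = {T. bij_betw T D {1..card D} \<and> (\<forall>b. b \<notin> D \<longrightarrow> T b = 0)}"

definition syt :: "box set \<Rightarrow> tableau set" where
  "syt D = {T \<in> young_tableaux D.
     (\<forall>x y y'. (x, y) \<in> D \<and> (x, y') \<in> D \<and> y < y' \<longrightarrow> T (x, y) < T (x, y')) \<and>
     (\<forall>x x' y. (x, y) \<in> D \<and> (x', y) \<in> D \<and> x < x' \<longrightarrow> T (x, y) < T (x', y))}"

definition box_of :: "box set \<Rightarrow> tableau \<Rightarrow> nat \<Rightarrow> box" where
  "box_of D T i = inv_into D T i"

definition adjacent :: "box \<Rightarrow> box \<Rightarrow> bool" where
  "adjacent b c \<longleftrightarrow>
     \<bar>int (fst b) - int (fst c)\<bar> + \<bar>int (snd b) - int (snd c)\<bar> = 1"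

definition same_component :: "box set \<Rightarrow> box \<Rightarrow> box \<Rightarrow> bool" where
  "same_component D b c \<longleftrightarrow> (b, c) \<in> {(p, q). p \<in> D \<and> q \<in> D \<and> adjacent p q}\<^sup>*"

text \<open>Of two boxes of a skew shape in different connected components, one always lies strictly
  south and strictly west of the other, so the following is a total order on the boxes.\<close>

definition reads_before :: "box set \<Rightarrow> box \<Rightarrow> box \<Rightarrow> bool" where
  "reads_before D b c \<longleftrightarrow>
     (if same_component D b c
      then snd b < snd c \<or> (snd b = snd c \<and> fst b < fst c)
      else fst c < fst b \<and> snd b < snd c)"

definition column_reading :: "box set \<Rightarrow> tableau" where
  "column_reading D b = (if b \<in> D then card {c \<in> D. c = b \<or> reads_before D c b} else 0)"

definition perm_of :: "box set \<Rightarrow> tableau \<Rightarrow> (nat \<Rightarrow> nat)" where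
  "perm_of D T = (THE w. w permutes {1..card D} \<and> w \<circ> column_reading D = T)"

definition inversions :: "box set \<Rightarrow> tableau \<Rightarrow> (nat \<times> nat) set" where
  "inversions D T = {(i, j). i \<in> {1..card D} \<and> j \<in> {1..card D} \<and> j < i \<and>
     fst (box_of D T j) < fst (box_of D T i) \<and> snd (box_of D T i) < snd (box_of D T j)}"

definition coef :: "box set \<Rightarrow> nat \<Rightarrow> nat \<Rightarrow> tableau \<Rightarrow> complex" where
  "coef D i j T = 1 / of_int (content (box_of D T j) - content (box_of D T i))"

text \<open>The vector space with basis the standard tableaux, realised as complex functions supported
  on \<open>syt D\<close>. The vector \<open>seminormal D T\<close> is 0 when \<open>T\<close> is not standard.\<close>

definition seminormal_space :: "box set \<Rightarrow> (tableau \<Rightarrow> complex) set" where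
  "seminormal_space D = {f. \<forall>T. T \<notin> syt D \<longrightarrow> f T = 0}"

definition scale :: "complex \<Rightarrow> (tableau \<Rightarrow> complex) \<Rightarrow> (tableau \<Rightarrow> complex)" where
  "scale c f = (\<lambda>T. c * f T)"

definition seminormal :: "box set \<Rightarrow> tableau \<Rightarrow> (tableau \<Rightarrow> complex)" where
  "seminormal D T = (\<lambda>S. if S = T \<and> T \<in> syt D then 1 else 0)"

text \<open>A module over the group algebra is given as a linear action \<open>\<rho>\<close> of the symmetric group.
  As the adjacent transpositions generate the group, \<open>\<rho>\<close> is determined on the symmetric group
  by the last conjunct.\<close>

definition seminormal_module ::
    "box set \<Rightarrow> ((nat \<Rightarrow> nat) \<Rightarrow> (tableau \<Rightarrow> complex) \<Rightarrow> (tableau \<Rightarrow> complex)) \<Rightarrow> bool" where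
  "seminormal_module D \<rho> \<longleftrightarrow>
     group_action (sym_group (card D)) (seminormal_space D) \<rho> \<and>
     (\<forall>\<sigma> \<in> carrier (sym_group (card D)). \<forall>f \<in> seminormal_space D.
        (\<forall>g \<in> seminormal_space D. \<rho> \<sigma> (f + g) = \<rho> \<sigma> f + \<rho> \<sigma> g) \<and>
        (\<forall>c. \<rho> \<sigma> (scale c f) = scale c (\<rho> \<sigma> f))) \<and>
     (\<forall>i \<in> {1..<card D}. \<forall>T \<in> syt D.
        \<rho> (transpose i (i + 1)) (seminormal D T) =
          scale (coef D i (i + 1) T) (seminormal D T) +
          scale (1 + coef D i (i + 1) T) (seminormal D (transpose i (i + 1) \<circ> T)))"

definition natural ::
    "box set \<Rightarrow> ((nat \<Rightarrow> nat) \<Rightarrow> (tableau \<Rightarrow> complex) \<Rightarrow> (tableau \<Rightarrow> complex)) \<Rightarrow>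
     tableau \<Rightarrow> (tableau \<Rightarrow> complex)" where
  "natural D \<rho> T = \<rho> (perm_of D T) (seminormal D (column_reading D))"

end

theory Submission
  imports Defs
begin

text \<open>
  The natural vector of \<open>T\<close> is triangular in the seminormal basis with respect to the number of
  inversions: besides \<open>v\<^sub>T\<close>, only \<open>v\<^sub>S\<close> with strictly fewer inversions than \<open>T\<close> occur. This
  lets one follow the diagonal coefficient along a chain of adjacent transpositions leading from
  the column reading tableau \<open>C\<close> to \<open>T\<close>.

  On a skew shape, boxes of different components lie southwest/northeast of each other, so the
  reading order of \<open>C\<close> is simply: by column, and downward within a column
  (\<open>reads_before_iff\<close>). If in a standard tableau \<open>T\<close> no \<open>i + 1\<close> lies strictly southwest of
  \<open>i\<close>, then consecutive entries follow the reading order and \<open>T = C\<close>. Otherwise exchanging such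
  \<open>i\<close> and \<open>i + 1\<close> gives a standard tableau \<open>T'\<close> with exactly one inversion fewer; this is the
  induction principle \<open>syt_descent_induct\<close>.

  In the induction step \<open>n\<^sub>T = s\<^sub>i n\<^sub>T\<^sub>'\<close>. Since \<open>s\<^sub>i\<close> sends \<open>v\<^sub>S\<close> into the span of \<open>v\<^sub>S\<close> and
  \<open>v\<^sub>s\<^sub>i\<^sub>S\<close>, and changes the number of inversions by at most one, triangularity is inherited, and
  the only contribution to the coefficient of \<open>v\<^sub>T\<close> comes from \<open>v\<^sub>T\<^sub>'\<close>. It multiplies the
  diagonal coefficient by \<open>1 + a\<^sub>i(T')\<close>. When inversions are recorded as pairs of boxes rather
  than pairs of entries, the factor of an inversion depends only on the contents of its two boxes
  and the inversions of \<open>T\<close> are those of \<open>T'\<close> together with the pair of boxes holding \<open>i + 1\<close>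
  and \<open>i\<close>; the new factor is precisely that of the new inversion. Both halves of the
  induction are in \<open>natural_triangular\<close>.
\<close>

section \<open>Skew shapes\<close>

text \<open>Convexity for the componentwise order on boxes characterises skew shapes among the finite
  sets of boxes; unlike a pair of partitions, it yields whole rectangles at once.\<close>

definition order_convex :: "box set \<Rightarrow> bool" where
  "order_convex D \<longleftrightarrow>
     (\<forall>x y x' y' u v. (x, y) \<in> D \<longrightarrow> (x', y') \<in> D \<longrightarrow>
        x \<le> u \<longrightarrow> u \<le> x' \<longrightarrow> y \<le> v \<longrightarrow> v \<le> y' \<longrightarrow> (u, v) \<in> D)"

lemma order_convexD:
  assumes "order_convex D" "b \<in> D" "c \<in> D"
    and "fst b \<le> u" "u \<le> fst c" "snd b \<le> v" "v \<le> snd c"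
  shows "(u, v) \<in> D"
proof -
  have "(fst b, snd b) \<in> D" "(fst c, snd c) \<in> D" using assms by auto
  then show ?thesis using assms unfolding order_convex_def by blast
qed

lemma finite_diagram:
  assumes "is_partition la"
  shows "finite (diagram la)"
proof -
  have "diagram la = (SIGMA x:{x. la x \<noteq> 0}. {..<la x})"
    by (auto simp: diagram_def)
  then show ?thesis using assms by (simp add: is_partition_def)
qed

lemma order_convex_skew:
  assumes "is_partition la" "is_partition mu"
  shows "order_convex (diagram la - diagram mu)"
  unfolding order_convex_def
proof (intro allI impI)
  fix x y x' y' u v :: nat
  assume b: "(x, y) \<in> diagram la - diagram mu" and c: "(x', y') \<in> diagram la - diagram mu"
    and "x \<le> u" "u \<le> x'" "y \<le> v" "v \<le> y'"
  have "la x' \<le> la u" "mu u \<le> mu x"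
    using assms \<open>u \<le> x'\<close> \<open>x \<le> u\<close> by (auto simp: is_partition_def antimono_def)
  with b c \<open>y \<le> v\<close> \<open>v \<le> y'\<close> show "(u, v) \<in> diagram la - diagram mu"
    by (auto simp: diagram_def)
qed

lemma same_component_trans:
  "same_component D b c \<Longrightarrow> same_component D c d \<Longrightarrow> same_component D b d"
  unfolding same_component_def by (rule rtrancl_trans)

lemma same_component_step:
  "b \<in> D \<Longrightarrow> c \<in> D \<Longrightarrow> adjacent b c \<Longrightarrow> same_component D b c"
  unfolding same_component_def by (rule r_into_rtrancl) auto

lemma same_component_down:
  assumes "\<And>u. x \<le> u \<Longrightarrow> u \<le> x + k \<Longrightarrow> (u, y) \<in> D"
  shows "same_component D (x, y) (x + k, y)"
  using assms
proof (induction k)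
  case 0
  show ?case by (simp add: same_component_def)
next
  case (Suc k)
  have "same_component D (x + k, y) (x + Suc k, y)"
    by (rule same_component_step) (auto simp: adjacent_def intro: Suc.prems)
  moreover have "same_component D (x, y) (x + k, y)"
    by (rule Suc.IH) (simp add: Suc.prems)
  ultimately show ?case by (rule same_component_trans[rotated])
qed

lemma same_component_right:
  assumes "\<And>v. y \<le> v \<Longrightarrow> v \<le> y + k \<Longrightarrow> (x, v) \<in> D"
  shows "same_component D (x, y) (x, y + k)"
  using assms
proof (induction k)
  case 0
  show ?case by (simp add: same_component_def)
next
  case (Suc k)
  have "same_component D (x, y + k) (x, y + Suc k)"
    by (rule same_component_step) (auto simp: adjacent_def intro: Suc.prems)
  moreover have "same_component D (x, y) (x, y + k)"
    by (rule Suc.IH) (simp add: Suc.prems)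
  ultimately show ?case by (rule same_component_trans[rotated])
qed

text \<open>By convexity the whole rectangle spanned by the two boxes lies in the shape, so one can
  walk down and then right.\<close>

lemma same_component_southeast:
  assumes "order_convex D" "b \<in> D" "c \<in> D" "fst b \<le> fst c" "snd b \<le> snd c"
  shows "same_component D b c"
proof -
  obtain x y where b: "b = (x, y)" by (cases b)
  obtain k l where c: "c = (x + k, y + l)"
    using assms(4,5) b by (cases c) (auto simp: le_iff_add)
  have in_D: "(u, v) \<in> D" if "x \<le> u" "u \<le> x + k" "y \<le> v" "v \<le> y + l" for u v
    by (rule order_convexD[OF assms(1-3)]) (use that b c in auto)
  have "same_component D (x, y) (x + k, y)"
    by (rule same_component_down) (simp add: in_D)
  moreover have "same_component D (x + k, y) (x + k, y + l)"
    by (rule same_component_right) (simp add: in_D)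
  ultimately show ?thesis unfolding b c by (rule same_component_trans)
qed

text \<open>The distinction of components is immaterial: if \<open>b\<close> lies west of \<open>c\<close> in another component,
  then it cannot lie weakly north of \<open>c\<close>, so it also comes first in the order on components.\<close>

lemma reads_before_iff:
  assumes "order_convex D" "b \<in> D" "c \<in> D"
  shows "reads_before D b c \<longleftrightarrow> snd b < snd c \<or> (snd b = snd c \<and> fst b < fst c)"
proof (cases "same_component D b c")
  case True
  then show ?thesis by (simp add: reads_before_def)
next
  case False
  then have "\<not> (fst b \<le> fst c \<and> snd b \<le> snd c)"
    using same_component_southeast[OF assms] by blast
  with False show ?thesis by (auto simp: reads_before_def)
qed

section \<open>Standard tableaux and their inversions\<close>

lemma tableau_bij: "T \<in> young_tableaux D \<Longrightarrow> bij_betw T D {1..card D}"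
  by (simp add: young_tableaux_def)

lemma tableau_outside: "T \<in> young_tableaux D \<Longrightarrow> b \<notin> D \<Longrightarrow> T b = 0"
  unfolding young_tableaux_def by blast

lemma syt_tableau: "T \<in> syt D \<Longrightarrow> T \<in> young_tableaux D"
  by (simp add: syt_def)

lemma tableau_range: "T \<in> young_tableaux D \<Longrightarrow> b \<in> D \<Longrightarrow> T b \<in> {1..card D}"
  using tableau_bij bij_betwE by blast

lemma tableau_eq_iff:
  "T \<in> young_tableaux D \<Longrightarrow> b \<in> D \<Longrightarrow> c \<in> D \<Longrightarrow> T b = T c \<longleftrightarrow> b = c"
  using tableau_bij[of T D] by (meson bij_betw_imp_inj_on inj_on_eq_iff)

lemma box_of_in:
  "T \<in> young_tableaux D \<Longrightarrow> i \<in> {1..card D} \<Longrightarrow> box_of D T i \<in> D"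
  unfolding box_of_def using tableau_bij[THEN bij_betw_imp_surj_on] by (metis inv_into_into)

lemma tableau_box_of:
  "T \<in> young_tableaux D \<Longrightarrow> i \<in> {1..card D} \<Longrightarrow> T (box_of D T i) = i"
  unfolding box_of_def using tableau_bij bij_betw_inv_into_right by fastforce

lemma box_of_tableau:
  "T \<in> young_tableaux D \<Longrightarrow> b \<in> D \<Longrightarrow> box_of D T (T b) = b"
  unfolding box_of_def using tableau_bij bij_betw_inv_into_left by fastforce

lemma finite_syt:
  assumes "finite D"
  shows "finite (syt D)"
proof (rule finite_subset)
  show "syt D \<subseteq> {T. \<forall>b. (b \<in> D \<longrightarrow> T b \<in> {1..card D}) \<and> (b \<notin> D \<longrightarrow> T b = 0)}"
    using syt_tableau tableau_range tableau_outside by blast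
  show "finite {T :: tableau. \<forall>b. (b \<in> D \<longrightarrow> T b \<in> {1..card D}) \<and> (b \<notin> D \<longrightarrow> T b = 0)}"
    by (rule finite_set_of_finite_funs) (use assms in auto)
qed

text \<open>Rows and columns are combined by passing through the southwest corner of the rectangle,
  which belongs to a convex shape.\<close>

lemma syt_mono:
  assumes "order_convex D" "T \<in> syt D" "b \<in> D" "c \<in> D"
    and "fst b \<le> fst c" "snd b \<le> snd c" "b \<noteq> c"
  shows "T b < T c"
proof -
  obtain x y x' y' where b: "b = (x, y)" and c: "c = (x', y')" by (cases b, cases c)
  have corner: "(x', y) \<in> D"
    by (rule order_convexD[OF assms(1,3,4)]) (use assms b c in auto)
  have "T (x, y) \<le> T (x', y)"
    using assms corner b c unfolding syt_def by (cases "x = x'") (auto simp: less_imp_le)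
  moreover have "T (x', y) \<le> T (x', y')"
    using assms corner b c unfolding syt_def by (cases "y = y'") (auto simp: less_imp_le)
  ultimately have "T b \<le> T c" by (simp add: b c)
  moreover have "T b \<noteq> T c" using assms tableau_eq_iff syt_tableau by blast
  ultimately show ?thesis by simp
qed

text \<open>The inversions of \<open>T\<close>, each given by the boxes of its two entries. In this form they are
  directly comparable for different tableaux of the same shape.\<close>

definition box_inversions :: "box set \<Rightarrow> tableau \<Rightarrow> (box \<times> box) set" where
  "box_inversions D T =
     {(b, c). b \<in> D \<and> c \<in> D \<and> fst c < fst b \<and> snd b < snd c \<and> T c < T b}"

lemma finite_box_inversions: "finite D \<Longrightarrow> finite (box_inversions D T)"
  by (rule finite_subset[of _ "D \<times> D"]) (auto simp: box_inversions_def)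

text \<open>The number \<open>1 + a\<^sub>i\<^sub>,\<^sub>j(T)\<close> for entries \<open>i\<close> and \<open>j\<close> in the boxes \<open>b\<close> and \<open>c\<close>: it does not
  depend on \<open>T\<close>.\<close>

definition box_weight :: "box \<Rightarrow> box \<Rightarrow> complex" where
  "box_weight b c = 1 + 1 / of_int (content c - content b)"

lemma prod_inversions:
  assumes "T \<in> young_tableaux D"
  shows "(\<Prod>(i, j) \<in> inversions D T. 1 + coef D i j T) =
         (\<Prod>(b, c) \<in> box_inversions D T. box_weight b c)"
proof (rule prod.reindex_bij_witness[where j = "\<lambda>(i, j). (box_of D T i, box_of D T j)"
      and i = "\<lambda>(b, c). (T b, T c)"])
  fix p assume "p \<in> inversions D T"
  then obtain i j where p: "p = (i, j)" "i \<in> {1..card D}" "j \<in> {1..card D}" "(i, j) \<in> inversions D T"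
    by (auto simp: inversions_def)
  note box = box_of_in[OF assms p(2)] box_of_in[OF assms p(3)]
    tableau_box_of[OF assms p(2)] tableau_box_of[OF assms p(3)]
  show "(case case p of (i, j) \<Rightarrow> (box_of D T i, box_of D T j) of (b, c) \<Rightarrow> (T b, T c)) = p"
    using p(1) box by simp
  show "(case p of (i, j) \<Rightarrow> (box_of D T i, box_of D T j)) \<in> box_inversions D T"
    using p(1,4) box by (simp add: inversions_def box_inversions_def)
  show "(case case p of (i, j) \<Rightarrow> (box_of D T i, box_of D T j) of (b, c) \<Rightarrow> box_weight b c) =
        (case p of (i, j) \<Rightarrow> 1 + coef D i j T)"
    using p(1) by (simp add: box_weight_def coef_def)
next
  fix p assume "p \<in> box_inversions D T"
  then obtain b c where p: "p = (b, c)" "b \<in> D" "c \<in> D" "(b, c) \<in> box_inversions D T"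
    by (auto simp: box_inversions_def)
  note box = box_of_tableau[OF assms p(2)] box_of_tableau[OF assms p(3)]
    tableau_range[OF assms p(2)] tableau_range[OF assms p(3)]
  show "(case case p of (b, c) \<Rightarrow> (T b, T c) of (i, j) \<Rightarrow> (box_of D T i, box_of D T j)) = p"
    using p(1) box by simp
  show "(case p of (b, c) \<Rightarrow> (T b, T c)) \<in> inversions D T"
    using p(1,4) box by (simp add: box_inversions_def inversions_def)
qed

section \<open>Exchanging consecutive entries\<close>

abbreviation adj_swap :: "nat \<Rightarrow> nat \<Rightarrow> nat" where
  "adj_swap i \<equiv> transpose i (i + 1)"

lemma adj_swap_permutes: "i \<in> {1..<n} \<Longrightarrow> adj_swap i permutes {1..n}"
  by (rule permutes_swap_id) auto

text \<open>Nothing lies between \<open>i\<close> and \<open>i + 1\<close>, so their exchange reverses the order of this one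
  pair only.\<close>

lemma adj_swap_less_iff:
  assumes "k \<noteq> l" "{k, l} \<noteq> {i, i + 1}"
  shows "adj_swap i k < adj_swap i l \<longleftrightarrow> k < l"
  using assms by (auto simp: transpose_def doubleton_eq_iff)

lemma adj_swap_comp_self: "adj_swap i \<circ> (adj_swap i \<circ> T) = T"
  by (simp add: fun_eq_iff)

lemma adj_swap_tableau:
  assumes "T \<in> young_tableaux D" "i \<in> {1..<card D}"
  shows "adj_swap i \<circ> T \<in> young_tableaux D"
proof -
  have "bij_betw (adj_swap i \<circ> T) D {1..card D}"
    using tableau_bij[OF assms(1)] permutes_imp_bij[OF adj_swap_permutes[OF assms(2)]]
    by (rule bij_betw_trans)
  moreover have "(adj_swap i \<circ> T) b = 0" if "b \<notin> D" for b
    using tableau_outside[OF assms(1) that] assms(2) by (simp add: transpose_def)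
  ultimately show ?thesis by (simp add: young_tableaux_def)
qed

lemma box_of_adj_swap:
  assumes "T \<in> young_tableaux D" "i \<in> {1..<card D}" "k \<in> {1..card D}"
  shows "box_of D (adj_swap i \<circ> T) k = box_of D T (adj_swap i k)"
proof -
  have k: "adj_swap i k \<in> {1..card D}"
    using permutes_in_image[OF adj_swap_permutes[OF assms(2)]] assms(3) by blast
  have "(adj_swap i \<circ> T) (box_of D T (adj_swap i k)) = k"
    using tableau_box_of[OF assms(1) k] by simp
  then show ?thesis
    using box_of_tableau[OF adj_swap_tableau[OF assms(1,2)] box_of_in[OF assms(1) k]] by simp
qed

definition strictly_southwest :: "box \<Rightarrow> box \<Rightarrow> bool" where
  "strictly_southwest b c \<longleftrightarrow> fst c < fst b \<and> snd b < snd c"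

lemma adj_swap_less_boxes:
  assumes "T \<in> young_tableaux D" "i \<in> {1..<card D}" "b \<in> D" "c \<in> D" "b \<noteq> c"
    and "{b, c} \<noteq> {box_of D T i, box_of D T (i + 1)}"
  shows "(adj_swap i \<circ> T) b < (adj_swap i \<circ> T) c \<longleftrightarrow> T b < T c"
proof -
  have "{T b, T c} \<noteq> {i, i + 1}"
  proof
    assume "{T b, T c} = {i, i + 1}"
    then have "box_of D T ` {T b, T c} = box_of D T ` {i, i + 1}" by simp
    then show False using assms box_of_tableau by simp
  qed
  then show ?thesis
    using adj_swap_less_iff[of "T b" "T c" i] tableau_eq_iff[OF assms(1,3,4)] assms(5) by simp
qed

text \<open>The only comparison that changes is between two boxes in different rows and different
  columns, which standardness does not constrain.\<close>

lemma adj_swap_syt: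
  assumes "T \<in> syt D" "i \<in> {1..<card D}"
    and sw: "strictly_southwest (box_of D T (i + 1)) (box_of D T i)"
  shows "adj_swap i \<circ> T \<in> syt D"
proof -
  note T = syt_tableau[OF assms(1)]
  have "(adj_swap i \<circ> T) b < (adj_swap i \<circ> T) c"
    if "b \<in> D" "c \<in> D" "fst b = fst c \<or> snd b = snd c" "T b < T c" for b c
  proof -
    have "{b, c} \<noteq> {box_of D T i, box_of D T (i + 1)}"
      using sw that(3) by (auto simp: strictly_southwest_def doubleton_eq_iff)
    moreover have "b \<noteq> c" using that(4) by auto
    ultimately show ?thesis using adj_swap_less_boxes[OF T assms(2) that(1,2)] that(4) by blast
  qed
  then show ?thesis
    using assms(1) adj_swap_tableau[OF T assms(2)] unfolding syt_def by force
qed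

text \<open>Here \<open>adj_swap i \<circ> T\<close> may fail to be standard; this generality is needed to compare
  the numbers of inversions of \<open>S\<close> and \<open>s\<^sub>i S\<close> for every standard \<open>S\<close>.\<close>

lemma box_inversions_adj_swap_subset:
  assumes "T \<in> young_tableaux D" "i \<in> {1..<card D}"
  shows "box_inversions D T \<subseteq>
    insert (box_of D T (i + 1), box_of D T i) (box_inversions D (adj_swap i \<circ> T))"
proof
  fix p assume p: "p \<in> box_inversions D T"
  then obtain b c where bc: "p = (b, c)" "b \<in> D" "c \<in> D" "fst c < fst b" "snd b < snd c"
      "T c < T b"
    by (auto simp: box_inversions_def)
  have T_box: "T (box_of D T i) = i" "T (box_of D T (i + 1)) = i + 1"
    using tableau_box_of[OF assms(1)] assms(2) by auto
  show "p \<in> insert (box_of D T (i + 1), box_of D T i) (box_inversions D (adj_swap i \<circ> T))"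
  proof (cases "{c, b} = {box_of D T i, box_of D T (i + 1)}")
    case True
    then have "b = box_of D T (i + 1) \<and> c = box_of D T i"
      using bc T_box by (auto simp: doubleton_eq_iff)
    then show ?thesis using bc by simp
  next
    case False
    then have "(adj_swap i \<circ> T) c < (adj_swap i \<circ> T) b"
      using adj_swap_less_boxes[OF assms bc(3,2)] bc by auto
    then show ?thesis using bc by (simp add: box_inversions_def)
  qed
qed

lemma card_box_inversions_adj_swap:
  assumes "finite D" "T \<in> young_tableaux D" "i \<in> {1..<card D}"
  shows "card (box_inversions D T) \<le> Suc (card (box_inversions D (adj_swap i \<circ> T)))"
proof -
  let ?X = "box_inversions D (adj_swap i \<circ> T)" and ?p = "(box_of D T (i + 1), box_of D T i)"
  have "card (box_inversions D T) \<le> card (insert ?p ?X)"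
    by (rule card_mono[OF _ box_inversions_adj_swap_subset[OF assms(2,3)]])
       (use finite_box_inversions[OF assms(1)] in blast)
  also have "\<dots> \<le> Suc (card ?X)"
    using finite_box_inversions[OF assms(1)] by (subst card_insert_if) auto
  finally show ?thesis .
qed

lemma box_inversions_adj_swap:
  assumes "T \<in> young_tableaux D" "i \<in> {1..<card D}"
    and sw: "strictly_southwest (box_of D T (i + 1)) (box_of D T i)"
  shows "box_inversions D T =
      insert (box_of D T (i + 1), box_of D T i) (box_inversions D (adj_swap i \<circ> T))"
    and "(box_of D T (i + 1), box_of D T i) \<notin> box_inversions D (adj_swap i \<circ> T)"
proof -
  let ?T = "adj_swap i \<circ> T"
  have i: "i \<in> {1..card D}" "i + 1 \<in> {1..card D}" using assms(2) by auto
  have T_box: "T (box_of D T i) = i" "T (box_of D T (i + 1)) = i + 1"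
    using tableau_box_of[OF assms(1)] i by auto
  have box: "box_of D ?T i = box_of D T (i + 1)" "box_of D ?T (i + 1) = box_of D T i"
    using box_of_adj_swap[OF assms(1,2)] i by auto
  have in_T: "(box_of D T (i + 1), box_of D T i) \<in> box_inversions D T"
    using sw box_of_in[OF assms(1)] i T_box by (simp add: box_inversions_def strictly_southwest_def)
  have no_rev: "(box_of D T i, box_of D T (i + 1)) \<notin> box_inversions D T"
    using T_box by (simp add: box_inversions_def)
  show "(box_of D T (i + 1), box_of D T i) \<notin> box_inversions D ?T"
    using T_box by (simp add: box_inversions_def)
  moreover have "box_inversions D ?T \<subseteq>
      insert (box_of D T i, box_of D T (i + 1)) (box_inversions D T)"
    using box_inversions_adj_swap_subset[OF adj_swap_tableau[OF assms(1,2)] assms(2)]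
    unfolding box adj_swap_comp_self .
  moreover have "(box_of D T i, box_of D T (i + 1)) \<notin> box_inversions D ?T"
    using sw by (auto simp: box_inversions_def strictly_southwest_def)
  ultimately show "box_inversions D T =
      insert (box_of D T (i + 1), box_of D T i) (box_inversions D ?T)"
    using box_inversions_adj_swap_subset[OF assms(1,2)] in_T by blast
qed

section \<open>Descent to the column reading tableau\<close>

lemma column_reading_mono:
  assumes "finite D" "order_convex D" "b \<in> D" "c \<in> D" "snd b < snd c"
  shows "column_reading D b < column_reading D c"
proof -
  have "reads_before D d c" if "d \<in> D" "d = b \<or> reads_before D d b" for d
    using reads_before_iff[OF assms(2) that(1)] that(2) assms(3-5) by auto
  moreover have "c \<noteq> b" "\<not> reads_before D c b"
    using reads_before_iff[OF assms(2,4,3)] assms(5) by auto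
  ultimately have "{d \<in> D. d = b \<or> reads_before D d b} \<subset> {d \<in> D. d = c \<or> reads_before D d c}"
    using assms(4) by blast
  then show ?thesis
    using assms by (simp add: column_reading_def psubset_card_mono)
qed

text \<open>By transitivity it suffices to compare the boxes of \<open>i\<close> and \<open>i + 1\<close>. If the box of
  \<open>i + 1\<close> came first, then, not being weakly northwest of the box of \<open>i\<close>, it would lie strictly
  southwest of it.\<close>

lemma reads_before_of_no_descent:
  assumes D: "order_convex D" and "T \<in> syt D" and "b \<in> D" "c \<in> D" "T b < T c"
    and no_descent: "\<And>i. i \<in> {1..<card D} \<Longrightarrow>
      \<not> strictly_southwest (box_of D T (i + 1)) (box_of D T i)"
  shows "reads_before D b c"
proof -
  note T = syt_tableau[OF assms(2)]
  have step: "reads_before D (box_of D T i) (box_of D T (i + 1))" if i: "i \<in> {1..<card D}" for i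
  proof -
    let ?b = "box_of D T i" and ?c = "box_of D T (i + 1)"
    have in_D: "?b \<in> D" "?c \<in> D" using box_of_in[OF T] i by auto
    have "T ?b = i" "T ?c = i + 1" using tableau_box_of[OF T] i by auto
    then have "\<not> (fst ?c \<le> fst ?b \<and> snd ?c \<le> snd ?b)"
      using syt_mono[OF D assms(2) in_D(2,1)] by fastforce
    then show ?thesis
      using no_descent[OF i] reads_before_iff[OF D in_D] unfolding strictly_southwest_def by linarith
  qed
  have chain: "reads_before D (box_of D T i) (box_of D T (i + Suc k))"
    if "1 \<le> i" "i + Suc k \<le> card D" for i k
    using that(2)
  proof (induction k)
    case 0
    then show ?case using step[of i] \<open>1 \<le> i\<close> by simp
  next
    case (Suc k)
    have in_D: "box_of D T i \<in> D" "box_of D T (i + Suc k) \<in> D" "box_of D T (i + Suc (Suc k)) \<in> D"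
      using box_of_in[OF T] Suc.prems \<open>1 \<le> i\<close> by auto
    have "reads_before D (box_of D T i) (box_of D T (i + Suc k))"
      by (rule Suc.IH) (use Suc.prems in simp)
    moreover have "reads_before D (box_of D T (i + Suc k)) (box_of D T (i + Suc (Suc k)))"
      using step[of "i + Suc k"] Suc.prems \<open>1 \<le> i\<close> by simp
    ultimately show ?case using reads_before_iff[OF D] in_D by auto
  qed
  have "1 \<le> T b" "T b + Suc (T c - Suc (T b)) = T c" "T c \<le> card D"
    using tableau_range[OF T] assms(3-5) by auto
  then show ?thesis
    using chain[of "T b" "T c - Suc (T b)"] box_of_tableau[OF T] assms(3,4) by simp
qed

text \<open>Entries now increase along the reading order, so each entry is the rank of its box in that
  order.\<close>

lemma column_reading_of_no_descent:
  assumes D: "order_convex D" and "T \<in> syt D"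
    and no_descent: "\<And>i. i \<in> {1..<card D} \<Longrightarrow>
      \<not> strictly_southwest (box_of D T (i + 1)) (box_of D T i)"
  shows "T = column_reading D"
proof
  note T = syt_tableau[OF assms(2)]
  fix b
  show "T b = column_reading D b"
  proof (cases "b \<in> D")
    case True
    have "c = b \<or> reads_before D c b \<longleftrightarrow> T c \<le> T b" if c: "c \<in> D" for c
    proof
      assume "c = b \<or> reads_before D c b"
      then have "c = b \<or> \<not> reads_before D b c"
        using reads_before_iff[OF D] c True by auto
      then show "T c \<le> T b"
        using reads_before_of_no_descent[OF D assms(2) True c _ no_descent] by fastforce
    next
      assume "T c \<le> T b"
      then show "c = b \<or> reads_before D c b"
        using reads_before_of_no_descent[OF D assms(2) c True _ no_descent]
          tableau_eq_iff[OF T c True] by (auto simp: le_less)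
    qed
    then have "{c \<in> D. c = b \<or> reads_before D c b} = {c \<in> D. T c \<le> T b}" by blast
    moreover have "bij_betw T {c \<in> D. T c \<le> T b} {1..T b}"
      using bij_betw_Collect[OF tableau_bij[OF T], of "\<lambda>k. k \<le> T b" "\<lambda>c. T c \<le> T b"]
        tableau_range[OF T True]
      by (simp add: bij_betw_def)
         (auto simp: bij_betw_def)
    ultimately show ?thesis
      using True bij_betw_same_card by (fastforce simp: column_reading_def)
  next
    case False
    then show ?thesis using tableau_outside[OF T] by (simp add: column_reading_def)
  qed
qed

text \<open>Every standard tableau descends to the column reading tableau through standard tableaux,
  losing one inversion at each step.\<close>

lemma syt_descent_induct [consumes 3, case_names column_reading adj_swap]:
  assumes "finite D" "order_convex D" "T \<in> syt D"
    and base: "column_reading D \<in> syt D \<Longrightarrow> P (column_reading D)"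
    and step: "\<And>T i. \<lbrakk>T \<in> syt D; i \<in> {1..<card D};
        strictly_southwest (box_of D T (i + 1)) (box_of D T i);
        adj_swap i \<circ> T \<in> syt D; P (adj_swap i \<circ> T)\<rbrakk> \<Longrightarrow> P T"
  shows "P T"
  using assms(3)
proof (induction "card (box_inversions D T)" arbitrary: T rule: less_induct)
  case less
  show ?case
  proof (cases "\<exists>i \<in> {1..<card D}. strictly_southwest (box_of D T (i + 1)) (box_of D T i)")
    case True
    then obtain i where i: "i \<in> {1..<card D}"
      and sw: "strictly_southwest (box_of D T (i + 1)) (box_of D T i)" by blast
    have "card (box_inversions D (adj_swap i \<circ> T)) < card (box_inversions D T)"
      using box_inversions_adj_swap[OF syt_tableau[OF less.prems] i sw]
        finite_box_inversions[OF assms(1)] by simp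
    then show ?thesis
      using less.hyps adj_swap_syt[OF less.prems i sw] step[OF less.prems i sw] by blast
  next
    case False
    then have "T = column_reading D"
      using column_reading_of_no_descent[OF assms(2) less.prems] by blast
    then show ?thesis using base less.prems by simp
  qed
qed

text \<open>The descent from any standard tableau ends in a standard tableau, which saves a direct
  verification that the ranks in the reading order form one.\<close>

lemma column_reading_syt:
  assumes "finite D" "order_convex D" "T \<in> syt D"
  shows "column_reading D \<in> syt D"
  using assms by (induction rule: syt_descent_induct)

lemma perm_of_unique:
  assumes "column_reading D \<in> young_tableaux D"
    and "w permutes {1..card D}" "w \<circ> column_reading D = T"
  shows "perm_of D T = w"
  unfolding perm_of_def
proof (rule the_equality)
  fix v assume v: "v permutes {1..card D} \<and> v \<circ> column_reading D = T"
  show "v = w"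
  proof
    fix k
    show "v k = w k"
    proof (cases "k \<in> {1..card D}")
      case True
      then obtain b where "k = column_reading D b"
        using tableau_box_of[OF assms(1)] by metis
      then show ?thesis using v assms(3) by (metis comp_apply)
    next
      case False
      then show ?thesis using v assms(2) permutes_not_in by metis
    qed
  qed
qed (use assms in simp)

text \<open>The permutation is the product of the adjacent transpositions met along the descent.\<close>

lemma perm_of_exists:
  assumes "finite D" "order_convex D" "T \<in> syt D"
  shows "\<exists>w. w permutes {1..card D} \<and> w \<circ> column_reading D = T"
  using assms
proof (induction rule: syt_descent_induct)
  case column_reading
  show ?case by (intro exI[of _ id] conjI permutes_id id_comp)
next
  case (adj_swap T i)
  then obtain w where "w permutes {1..card D}" "w \<circ> column_reading D = adj_swap i \<circ> T" by blast
  then have "(adj_swap i \<circ> w) permutes {1..card D}" "(adj_swap i \<circ> w) \<circ> column_reading D = T"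
    using permutes_compose[OF _ adj_swap_permutes[OF adj_swap.hyps(2)]] adj_swap_comp_self
    by (metis, metis comp_assoc)
  then show ?case by blast
qed

section \<open>Matrix entries of an adjacent transposition\<close>

lemma seminormal_in_space: "seminormal D T \<in> seminormal_space D"
  by (auto simp: seminormal_def seminormal_space_def)

lemma scale_in_space: "f \<in> seminormal_space D \<Longrightarrow> scale c f \<in> seminormal_space D"
  by (auto simp: scale_def seminormal_space_def)

lemma sum_fun_apply:
  fixes F :: "'a \<Rightarrow> 'b \<Rightarrow> 'c :: comm_monoid_add"
  shows "(\<Sum>R\<in>X. F R) S = (\<Sum>R\<in>X. F R S)"
  by (induction X rule: infinite_finite_induct) simp_all

lemma sum_in_space:
  "(\<And>R. R \<in> X \<Longrightarrow> F R \<in> seminormal_space D) \<Longrightarrow> (\<Sum>R\<in>X. F R) \<in> seminormal_space D"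
  by (auto simp: seminormal_space_def sum_fun_apply)

lemma sum_seminormal_apply:
  assumes "finite D" "S \<in> syt D"
  shows "(\<Sum>R \<in> syt D. scale (c R) (seminormal D R)) S = c S"
proof -
  have "(\<Sum>R \<in> syt D. scale (c R) (seminormal D R)) S = (\<Sum>R \<in> syt D. if S = R then c R else 0)"
    by (simp add: sum_fun_apply scale_def seminormal_def if_distrib cong: if_cong)
  then show ?thesis using assms finite_syt by simp
qed

lemma seminormal_expansion:
  assumes "finite D" "f \<in> seminormal_space D"
  shows "f = (\<Sum>R \<in> syt D. scale (f R) (seminormal D R))"
proof
  fix S
  show "f S = (\<Sum>R \<in> syt D. scale (f R) (seminormal D R)) S"
  proof (cases "S \<in> syt D")
    case True
    then show ?thesis using sum_seminormal_apply[OF assms(1), of S f] by simp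
  next
    case False
    moreover have "(\<Sum>R \<in> syt D. scale (f R) (seminormal D R)) \<in> seminormal_space D"
      by (intro sum_in_space scale_in_space seminormal_in_space)
    ultimately show ?thesis using assms(2) by (simp add: seminormal_space_def)
  qed
qed

lemma module_action:
  "seminormal_module D \<rho> \<Longrightarrow> group_action (sym_group (card D)) (seminormal_space D) \<rho>"
  by (simp add: seminormal_module_def)

lemma module_sum:
  assumes M: "seminormal_module D \<rho>" and \<sigma>: "\<sigma> permutes {1..card D}" and "finite X"
    and F: "\<And>R. R \<in> X \<Longrightarrow> F R \<in> seminormal_space D"
  shows "\<rho> \<sigma> (\<Sum>R\<in>X. scale (c R) (F R)) = (\<Sum>R\<in>X. scale (c R) (\<rho> \<sigma> (F R)))"
  using \<open>finite X\<close> F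
proof (induction X rule: finite_induct)
  case empty
  have \<sigma>': "\<sigma> \<in> carrier (sym_group (card D))" using \<sigma> by (simp add: sym_group_carrier)
  have zero: "(0 :: tableau \<Rightarrow> complex) \<in> seminormal_space D" by (simp add: seminormal_space_def)
  have "\<rho> \<sigma> (scale 0 0) = scale 0 (\<rho> \<sigma> 0)"
    using M \<sigma>' zero unfolding seminormal_module_def by blast
  moreover have "scale 0 f = 0" for f :: "tableau \<Rightarrow> complex" by (simp add: scale_def fun_eq_iff)
  ultimately show ?case by (simp only: sum.empty)
next
  case (insert R X)
  have \<sigma>': "\<sigma> \<in> carrier (sym_group (card D))" using \<sigma> by (simp add: sym_group_carrier)
  have "scale (c R) (F R) \<in> seminormal_space D" "(\<Sum>R\<in>X. scale (c R) (F R)) \<in> seminormal_space D"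
    using insert.prems by (auto intro!: scale_in_space sum_in_space)
  then have "\<rho> \<sigma> (scale (c R) (F R) + (\<Sum>R\<in>X. scale (c R) (F R))) =
      \<rho> \<sigma> (scale (c R) (F R)) + \<rho> \<sigma> (\<Sum>R\<in>X. scale (c R) (F R))"
    using M \<sigma>' unfolding seminormal_module_def by blast
  moreover have "\<rho> \<sigma> (scale (c R) (F R)) = scale (c R) (\<rho> \<sigma> (F R))"
    using M \<sigma>' insert.prems unfolding seminormal_module_def by blast
  moreover have "\<rho> \<sigma> (\<Sum>R\<in>X. scale (c R) (F R)) = (\<Sum>R\<in>X. scale (c R) (\<rho> \<sigma> (F R)))"
    using insert.IH insert.prems by blast
  ultimately show ?case by (simp only: sum.insert[OF insert.hyps(1,2)])
qed

text \<open>The coefficient of \<open>v\<^sub>S\<close> in \<open>s\<^sub>i f\<close> receives contributions from \<open>v\<^sub>S\<close> and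
  \<open>v\<^sub>s\<^sub>i\<^sub>S\<close> only. The formula also holds when \<open>s\<^sub>i S\<close> is not standard, because \<open>f\<close> vanishes
  there.\<close>

lemma adj_swap_action:
  assumes M: "seminormal_module D \<rho>" and "finite D" and i: "i \<in> {1..<card D}"
    and f: "f \<in> seminormal_space D" and S: "S \<in> syt D"
  shows "\<rho> (adj_swap i) f S = coef D i (i + 1) S * f S +
     (1 + coef D i (i + 1) (adj_swap i \<circ> S)) * f (adj_swap i \<circ> S)"
proof -
  let ?a = "coef D i (i + 1)" and ?s = "\<lambda>T. adj_swap i \<circ> T"
  have swap_eq: "S = ?s R \<longleftrightarrow> ?s S = R" for R
    using adj_swap_comp_self by metis
  have summand: "scale (f R) (\<rho> (adj_swap i) (seminormal D R)) S =
      (if S = R then ?a R * f R else 0) + (if ?s S = R then (1 + ?a R) * f R else 0)"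
    if R: "R \<in> syt D" for R
  proof -
    have "\<rho> (adj_swap i) (seminormal D R) =
        scale (?a R) (seminormal D R) + scale (1 + ?a R) (seminormal D (?s R))"
      using M i R unfolding seminormal_module_def by blast
    moreover have "seminormal D R S = (if S = R then 1 else 0)"
      using R by (simp add: seminormal_def)
    moreover have "seminormal D (?s R) S = (if ?s S = R then 1 else 0)"
      unfolding seminormal_def swap_eq[of R, symmetric] using S by (cases "S = ?s R") simp_all
    ultimately show ?thesis
      by (simp add: scale_def algebra_simps)
  qed
  have "\<rho> (adj_swap i) f = (\<Sum>R \<in> syt D. scale (f R) (\<rho> (adj_swap i) (seminormal D R)))"
    by (subst seminormal_expansion[OF assms(2) f])
       (rule module_sum[OF M adj_swap_permutes[OF i] finite_syt[OF assms(2)] seminormal_in_space])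
  then have "\<rho> (adj_swap i) f S = (\<Sum>R \<in> syt D.
      (if S = R then ?a R * f R else 0) + (if ?s S = R then (1 + ?a R) * f R else 0))"
    using summand by (simp add: sum_fun_apply)
  also have "\<dots> = ?a S * f S + (if ?s S \<in> syt D then (1 + ?a (?s S)) * f (?s S) else 0)"
    using S finite_syt[OF assms(2)] by (simp add: sum.distrib)
  also have "\<dots> = ?a S * f S + (1 + ?a (?s S)) * f (?s S)"
    using f by (simp add: seminormal_space_def)
  finally show ?thesis .
qed

section \<open>The natural basis\<close>

lemma natural_column_reading:
  assumes M: "seminormal_module D \<rho>" and C: "column_reading D \<in> young_tableaux D"
  shows "natural D \<rho> (column_reading D) = seminormal D (column_reading D)"
proof -
  interpret group_action "sym_group (card D)" "seminormal_space D" \<rho> by (rule module_action[OF M])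
  have "perm_of D (column_reading D) = id"
    by (rule perm_of_unique[OF C]) (simp_all add: permutes_id)
  then show ?thesis
    using id_eq_one seminormal_in_space[of D "column_reading D"]
    by (metis natural_def restrict_apply sym_group_one)
qed

lemma natural_in_space:
  assumes M: "seminormal_module D \<rho>" and "finite D" "order_convex D" "T \<in> syt D"
  shows "natural D \<rho> T \<in> seminormal_space D"
proof -
  interpret group_action "sym_group (card D)" "seminormal_space D" \<rho> by (rule module_action[OF M])
  obtain w where w: "w permutes {1..card D}" "w \<circ> column_reading D = T"
    using perm_of_exists[OF assms(2-4)] by blast
  then have "perm_of D T = w"
    using perm_of_unique syt_tableau column_reading_syt[OF assms(2-4)] by blast
  then show ?thesis
    using element_image[of w, OF _ seminormal_in_space refl] w
    by (simp add: natural_def sym_group_carrier)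
qed

lemma natural_adj_swap:
  assumes M: "seminormal_module D \<rho>" and "finite D" "order_convex D" "T \<in> syt D"
    and i: "i \<in> {1..<card D}"
  shows "natural D \<rho> (adj_swap i \<circ> T) = \<rho> (adj_swap i) (natural D \<rho> T)"
proof -
  interpret group_action "sym_group (card D)" "seminormal_space D" \<rho> by (rule module_action[OF M])
  note C = syt_tableau[OF column_reading_syt[OF assms(2-4)]]
  obtain w where w: "w permutes {1..card D}" "w \<circ> column_reading D = T"
    using perm_of_exists[OF assms(2-4)] by blast
  have "perm_of D T = w" by (rule perm_of_unique[OF C w])
  moreover have "perm_of D (adj_swap i \<circ> T) = adj_swap i \<circ> w"
    by (rule perm_of_unique[OF C permutes_compose[OF w(1) adj_swap_permutes[OF i]]])
       (simp add: w(2)[symmetric] comp_assoc)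
  ultimately show ?thesis
    using composition_rule[OF seminormal_in_space, of "adj_swap i" w] w adj_swap_permutes[OF i]
    by (simp add: natural_def sym_group_carrier sym_group_mult)
qed

text \<open>The diagonal coefficient can only be followed along a descent together with triangularity:
  for \<open>T' = s\<^sub>i T\<close> with one inversion fewer than \<open>T\<close>, the coefficient of \<open>v\<^sub>T\<close> in \<open>s\<^sub>i n\<^sub>T\<^sub>'\<close>
  is a combination of the coefficients of \<open>v\<^sub>T\<close> and \<open>v\<^sub>T\<^sub>'\<close> in \<open>n\<^sub>T\<^sub>'\<close>, and the
  former must be known to vanish. Comparing numbers of inversions is enough for this.\<close>

lemma natural_triangular:
  assumes M: "seminormal_module D \<rho>" and D: "finite D" "order_convex D" and T: "T \<in> syt D"
  shows "natural D \<rho> T T = (\<Prod>(b, c) \<in> box_inversions D T. box_weight b c) \<and>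
    (\<forall>S \<in> syt D. S \<noteq> T \<longrightarrow> card (box_inversions D T) \<le> card (box_inversions D S) \<longrightarrow>
       natural D \<rho> T S = 0)"
  using D T
proof (induction rule: syt_descent_induct)
  case column_reading
  let ?C = "column_reading D"
  have "box_inversions D ?C = {}"
    using column_reading_mono[OF D] by (fastforce simp: box_inversions_def)
  then show ?case
    using natural_column_reading[OF M syt_tableau[OF column_reading]] column_reading
    by (simp add: seminormal_def)
next
  case (adj_swap T i)
  let ?s = "\<lambda>T. adj_swap i \<circ> T"
  let ?inv = "\<lambda>T. card (box_inversions D T)"
  note i = adj_swap.hyps(2) and T = syt_tableau[OF adj_swap.hyps(1)]
  note inv_T = box_inversions_adj_swap[OF T adj_swap.hyps(2,3)]
  have card_T: "?inv T = Suc (?inv (?s T))"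
    using inv_T finite_box_inversions[OF D(1)] by simp
  have action: "natural D \<rho> T S = coef D i (i + 1) S * natural D \<rho> (?s T) S +
      (1 + coef D i (i + 1) (?s S)) * natural D \<rho> (?s T) (?s S)" if "S \<in> syt D" for S
    using natural_adj_swap[OF M D adj_swap.hyps(4) i]
      adj_swap_action[OF M D(1) i natural_in_space[OF M D adj_swap.hyps(4)] that]
    unfolding adj_swap_comp_self by simp
  have vanish: "natural D \<rho> (?s T) S = 0" if "S \<noteq> ?s T" "?inv (?s T) \<le> ?inv S" for S
  proof (cases "S \<in> syt D")
    case True
    then show ?thesis using adj_swap.IH that by blast
  next
    case False
    then show ?thesis
      using natural_in_space[OF M D adj_swap.hyps(4)] unfolding seminormal_space_def by blast
  qed
  have "natural D \<rho> T T = (\<Prod>(b, c) \<in> box_inversions D T. box_weight b c)"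
  proof -
    \<comment> \<open>The exchange puts \<open>i\<close> into the box where \<open>T\<close> has \<open>i + 1\<close>, so the coefficient of
      \<open>s\<^sub>i\<close> at \<open>?s T\<close> is that of the inversion \<open>(i + 1, i)\<close> of \<open>T\<close>.\<close>
    have "1 + coef D i (i + 1) (?s T) = box_weight (box_of D T (i + 1)) (box_of D T i)"
      using box_of_adj_swap[OF T i, of i] box_of_adj_swap[OF T i, of "i + 1"] i
      unfolding coef_def box_weight_def by simp
    moreover have "natural D \<rho> (?s T) T = 0"
      using vanish[of T] card_T by force
    moreover have "natural D \<rho> (?s T) (?s T) =
        (\<Prod>(b, c) \<in> box_inversions D (?s T). box_weight b c)"
      using adj_swap.IH by blast
    ultimately show ?thesis
      using action[OF adj_swap.hyps(1)] inv_T finite_box_inversions[OF D(1)] by simp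
  qed
  moreover have "natural D \<rho> T S = 0" if S: "S \<in> syt D" "S \<noteq> T" "?inv T \<le> ?inv S" for S
  proof -
    \<comment> \<open>Both \<open>S\<close> and \<open>?s S\<close> have at least as many inversions as \<open>?s T\<close>, and neither
      equals it.\<close>
    have "?inv S \<le> Suc (?inv (?s S))"
      by (rule card_box_inversions_adj_swap[OF D(1) syt_tableau[OF S(1)] i])
    moreover have "?s S \<noteq> ?s T" using S(2) adj_swap_comp_self by metis
    moreover have "S \<noteq> ?s T" using S(3) card_T by auto
    ultimately have "natural D \<rho> (?s T) (?s S) = 0" "natural D \<rho> (?s T) S = 0"
      using vanish[of "?s S"] vanish[of S] S(3) card_T by auto
    then show ?thesis using action[OF S(1)] by simp
  qed
  ultimately show ?case by blast
qed

theorem proposition4p15: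
  fixes la mu :: "nat \<Rightarrow> nat"
    and D :: "box set"
    and \<rho> :: "(nat \<Rightarrow> nat) \<Rightarrow> (tableau \<Rightarrow> complex) \<Rightarrow> (tableau \<Rightarrow> complex)"
    and A :: "tableau \<Rightarrow> tableau \<Rightarrow> complex"
    and T :: tableau
  assumes "is_partition la" and "is_partition mu" and "diagram mu \<subseteq> diagram la"
    and "D = diagram la - diagram mu"
    and "seminormal_module D \<rho>"
    and "\<forall>T \<in> syt D. natural D \<rho> T = (\<Sum>S \<in> syt D. scale (A S T) (seminormal D S))"
    and "T \<in> syt D"
  shows "A T T = (\<Prod>(i, j) \<in> inversions D T. 1 + coef D i j T)"
proof -
  have D: "finite D" "order_convex D"
    using finite_diagram[OF assms(1)] order_convex_skew[OF assms(1,2)] assms(4) by auto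
  have "A T T = natural D \<rho> T T"
    using assms(6,7) sum_seminormal_apply[OF D(1) assms(7), of "\<lambda>S. A S T"] by simp
  also have "\<dots> = (\<Prod>(b, c) \<in> box_inversions D T. box_weight b c)"
    using natural_triangular[OF assms(5) D assms(7)] by blast
  also have "\<dots> = (\<Prod>(i, j) \<in> inversions D T. 1 + coef D i j T)"
    by (rule prod_inversions[OF syt_tableau[OF assms(7)], symmetric])
  finally show ?thesis .
qed

end
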